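(* Let $a<b$ be real numbers, let $d\in[0,1)$, and let $f:\mathbb{R}^n\to\mathbb{R}^n$ be a $d$-demicontractive mapping having a fixed point in $[a,b]^n$. Let $\alpha\in(0,1-d)$ and $f_\alpha=\alpha f+(1-\alpha)\mathrm{Id}$. Then for every $\mathbf{x}\in[a,b]^n$, $$\frac1n\|f_\alpha(\mathbf{x})-\mathbf{x}\|^2\le\sigma^2(\alpha)\,c,$$ where $\sigma^2(\alpha)=\frac{\alpha}{1-d-\alpha}$ and $c=(b-a)^2$.
   Context: $\|\cdot\|$ is the Euclidean norm on $\mathbb{R}^n$ and $\mathrm{Id}$ is the identity. For $T:\mathbb{R}^n\to\mathbb{R}^n$, $\mathrm{Fix}(T)=\{\mathbf{x}\in\mathbb{R}^n: T(\mathbf{x})=\mathbf{x}\}$. The mapping $T$ is $d$-demicontractive, $d\in[0,1)$, if for all $\mathbf{x}\in\mathbb{R}^n$ and all $\mathbf{z}\in\mathrm{Fix}(T)$, $$\|T(\mathbf{x})-\mathbf{z}\|^2\le\|\mathbf{x}-\mathbf{z}\|^2+d\,\|T(\mathbf{x})-\mathbf{x}\|^2 .$$ *)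

theory Defs
  imports "HOL-Analysis.Analysis"
begin

definition Fix :: "(real ^ 'n \<Rightarrow> real ^ 'n) \<Rightarrow> (real ^ 'n) set" where
  "Fix T = {x. T x = x}"

text \<open>The fixed-point set is not required to be nonempty here.\<close>

definition demicontractive :: "real \<Rightarrow> (real ^ 'n \<Rightarrow> real ^ 'n) \<Rightarrow> bool" where
  "demicontractive d T \<longleftrightarrow> 0 \<le> d \<and> d < 1 \<and>
     (\<forall>x. \<forall>z\<in>Fix T. (norm (T x - z))\<^sup>2 \<le> (norm (x - z))\<^sup>2 + d * (norm (T x - x))\<^sup>2)"

definition averaged :: "real \<Rightarrow> (real ^ 'n \<Rightarrow> real ^ 'n) \<Rightarrow> real ^ 'n \<Rightarrow> real ^ 'n" where
  "averaged \<alpha> f = (\<lambda>x. \<alpha> *\<^sub>R f x + (1 - \<alpha>) *\<^sub>R id x)"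

definition cube :: "real \<Rightarrow> real \<Rightarrow> (real ^ 'n) set" where
  "cube a b = {x. \<forall>i. x $ i \<in> {a..b}}"

end

theory Submission
  imports Defs
begin

text \<open>
  Let \<open>z\<close> be a fixed point in the cube, \<open>u = f x - x\<close> and \<open>w = x - z\<close>. Demicontractivity says
  \<open>(1 - d) \<parallel>u\<parallel>\<^sup>2 + 2 (u \<bullet> w) \<le> 0\<close>; expanding \<open>0 \<le> \<parallel>\<alpha> u + w\<parallel>\<^sup>2\<close> then gives
  \<open>\<alpha> (1 - d - \<alpha>) \<parallel>u\<parallel>\<^sup>2 \<le> \<parallel>w\<parallel>\<^sup>2\<close>, and \<open>\<parallel>w\<parallel>\<^sup>2 \<le> n (b - a)\<^sup>2\<close> because both points lie in the cube.
\<close>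

lemma averaged_minus_self: "averaged \<alpha> f x - x = \<alpha> *\<^sub>R (f x - x)"
  by (simp add: averaged_def algebra_simps)

text \<open>Each coordinate contributes at most \<open>(b - a)\<^sup>2\<close>; summing over the
  coordinates produces the dimension factor.\<close>

lemma norm_diff_cube_le:
  fixes x z :: "real ^ 'n"
  assumes "x \<in> cube a b" "z \<in> cube a b"
  shows "(norm (x - z))\<^sup>2 \<le> real CARD('n) * (b - a)\<^sup>2"
proof -
  have "((x - z) $ i)\<^sup>2 \<le> (b - a)\<^sup>2" for i
  proof -
    have "x $ i \<in> {a..b}" "z $ i \<in> {a..b}"
      using assms by (auto simp: cube_def)
    then have "\<bar>(x - z) $ i\<bar> \<le> \<bar>b - a\<bar>"
      by auto
    then show ?thesis
      by (simp only: abs_le_square_iff)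
  qed
  then have "(\<Sum>i\<in>UNIV. ((x - z) $ i)\<^sup>2) \<le> (\<Sum>i\<in>(UNIV :: 'n set). (b - a)\<^sup>2)"
    by (intro sum_mono)
  then show ?thesis
    by (simp add: norm_vec_def L2_set_def sum_nonneg)
qed

lemma demicontractive_averaged_step_le:
  assumes "demicontractive d f" "z \<in> Fix f" "0 \<le> \<alpha>" "\<alpha> < 1 - d"
  shows "(norm (averaged \<alpha> f x - x))\<^sup>2 \<le> \<alpha> / (1 - d - \<alpha>) * (norm (x - z))\<^sup>2"
proof -
  define u w where "u = f x - x" and "w = x - z"
  have "f x - z = u + w"
    by (simp add: u_def w_def)
  then have "(norm (u + w))\<^sup>2 \<le> (norm w)\<^sup>2 + d * (norm u)\<^sup>2"
    using assms(1,2) by (metis demicontractive_def u_def w_def)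
  then have "(1 - d) * (norm u)\<^sup>2 + 2 * (u \<bullet> w) \<le> 0"
    by (simp add: power2_norm_eq_inner inner_simps inner_commute algebra_simps)
  then have "\<alpha> * ((1 - d) * (norm u)\<^sup>2 + 2 * (u \<bullet> w)) \<le> 0"
    using assms(3) by (simp add: mult_nonneg_nonpos)
  \<comment> \<open>The weight \<open>\<alpha>\<close> on \<open>u\<close> makes the cross term
    \<open>2 * \<alpha> * (u \<bullet> w)\<close> the one in the previous inequality, so subtracting
    eliminates it.\<close>
  moreover have "0 \<le> (norm (\<alpha> *\<^sub>R u + w))\<^sup>2"
    by simp
  then have "0 \<le> \<alpha>\<^sup>2 * (norm u)\<^sup>2 + 2 * \<alpha> * (u \<bullet> w) + (norm w)\<^sup>2"
    unfolding power2_norm_eq_inner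
    by (simp add: inner_simps inner_commute algebra_simps power2_eq_square)
  ultimately have "\<alpha> * (1 - d - \<alpha>) * (norm u)\<^sup>2 \<le> (norm w)\<^sup>2"
    by (simp add: algebra_simps power2_eq_square)
  \<comment> \<open>The extra factor \<open>\<alpha>\<close> completes the square
    \<open>(\<alpha> * norm u)\<^sup>2\<close>, the squared length of the averaged step.\<close>
  then have "\<alpha> * (\<alpha> * (1 - d - \<alpha>) * (norm u)\<^sup>2) \<le> \<alpha> * (norm w)\<^sup>2"
    using assms(3) by (rule mult_left_mono)
  then have "(\<alpha> * norm u)\<^sup>2 \<le> \<alpha> / (1 - d - \<alpha>) * (norm w)\<^sup>2"
    using assms(4) by (simp add: pos_le_divide_eq power2_eq_square mult_ac)
  then show ?thesis
    using assms(3) by (simp add: averaged_minus_self u_def w_def)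
qed

theorem proposition3p10:
  fixes a b d \<alpha> :: real
    and f :: "real ^ 'n \<Rightarrow> real ^ 'n"
  assumes "a < b"
    and "d \<in> {0..<1}"
    and "demicontractive d f"
    and "\<exists>z\<in>cube a b. z \<in> Fix f"
    and "\<alpha> \<in> {0<..<1 - d}"
  shows "\<forall>x\<in>cube a b.
    1 / real CARD('n) * (norm (averaged \<alpha> f x - x))\<^sup>2 \<le> \<alpha> / (1 - d - \<alpha>) * (b - a)\<^sup>2"
proof
  fix x :: "real ^ 'n"
  assume x: "x \<in> cube a b"
  obtain z where z: "z \<in> cube a b" "z \<in> Fix f"
    using assms(4) by blast
  have \<alpha>: "0 \<le> \<alpha>" "\<alpha> < 1 - d"
    using assms(5) by auto
  have "(norm (averaged \<alpha> f x - x))\<^sup>2 \<le> \<alpha> / (1 - d - \<alpha>) * (norm (x - z))\<^sup>2"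
    using demicontractive_averaged_step_le[OF assms(3) z(2) \<alpha>] .
  \<comment> \<open>The dimension factor introduced here cancels against the normalization in the
    goal.\<close>
  also have "\<dots> \<le> \<alpha> / (1 - d - \<alpha>) * (real CARD('n) * (b - a)\<^sup>2)"
    using \<alpha> by (intro mult_left_mono norm_diff_cube_le x z) auto
  finally show "1 / real CARD('n) * (norm (averaged \<alpha> f x - x))\<^sup>2
      \<le> \<alpha> / (1 - d - \<alpha>) * (b - a)\<^sup>2"
    by (simp add: pos_divide_le_eq mult_ac)
qed

end
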